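(* Let $\hat{B}_k[\cdot]$ be the (symmetric) nonlinear AMLI-cycle multigrid operator and let $\tilde{B}_k[\cdot]$ be given by $n\ge1$ steps of the (full) nonlinear PCG method with $\hat{B}_k[\cdot]$ as the preconditioner. Assume the approximation property: for all $2\le k\le J$ and all $v\in V_k$, $\|(I-P_{k-1})v\|_{A_k}^2\le \frac{c_1}{\rho(A_k)}\|A_kv\|^2$; and the smoothing property: for all $2\le k\le J$ and all $v\in V_k$, $\frac{c_2}{\rho(A_k)}(v,v)\le(\tilde R_kv,v)$; where $c_1,c_2>0$ are constants independent of $k$. Then, with $\delta=\frac{c_1}{c_1+c_2}<1$ (independent of $k$), for every $k\in\{1,\dots,J\}$ and every $v\in V_k$, $$\| v - \hat{B}_k[A_kv] \|_{A_k}^2 \leq \delta \| v \|_{A_k}^2,\qquad \| v - \tilde{B}_k[A_kv] \|_{A_k}^2 \leq \delta^n \| v \|_{A_k}^2.$$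
   Context: Setting. $V$ is a finite-dimensional real vector space with inner product $(\cdot,\cdot)$ and norm $\|\cdot\|$; $A:V\to V$ is symmetric positive definite (SPD) with respect to $(\cdot,\cdot)$; $(u,v)_A=(Au,v)$. $V_1\subset V_2\subset\cdots\subset V_J=V$ are nested subspaces. $Q_k,P_k:V\to V_k$ are the orthogonal projections with respect to $(\cdot,\cdot)$ and $(\cdot,\cdot)_A$. $A_k:V_k\to V_k$ is defined by $(A_ku_k,v_k)=(u_k,v_k)_A$ for $u_k,v_k\in V_k$; it is SPD, $(u,v)_{A_k}=(A_ku,v)$, with norm $\|\cdot\|_{A_k}$ (also used for the induced operator norm); $\rho(A_k)$ is the spectral radius. $R_k:V_k\to V_k$ ($2\le k\le J$) are given linear smoothers, always assumed convergent: $\|I-R_kA_k\|_{A_k}<1$; $R_k^t$ is the adjoint of $R_k$ with respect to $(\cdot,\cdot)$, and $\tilde R_k$ is defined by $I-\tilde R_kA_k=(I-R_kA_k)(I-R_k^tA_k)$. Nonlinear PCG ($n$ steps, full version, $n\ge1$ fixed) on $V_k$ with a given, possibly nonlinear, preconditioner $\hat B_k[\cdot]:V_k\to V_k$: for $f\in V_k$ put $u_0=0$, $r_0=f$, $p_0=\hat B_k[r_0]$; for $i=1,\dots,n-1$, $p_i=\hat B_k[r_i]+\sum_{j=0}^{i-1}\beta_{i,j}p_j$ with $\beta_{i,j}=-(\hat B_k[r_i],p_j)_{A_k}/(p_j,p_j)_{A_k}$; for $i=0,\dots,n-1$, $\alpha_i=(r_i,p_i)/(p_i,p_i)_{A_k}$,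 $u_{i+1}=u_i+\alpha_ip_i$, $r_{i+1}=r_i-\alpha_iA_kp_i$. The output is $\tilde B_k[f]:=u_n$. Convention: a coefficient $\alpha_i$ or $\beta_{i,j}$ whose denominator vanishes is taken to be $0$. Nonlinear AMLI-cycle: $\hat B_1[f]=A_1^{-1}f$ and, for $k\ge2$, $f\in V_k$: $u_1=R_kf$, $u_2=u_1+\tilde B_{k-1}[Q_{k-1}(f-A_ku_1)]$, $\hat B_k[f]=u_2+R_k^t(f-A_ku_2)$, where on each level $\tilde B_{j}[\cdot]$ is the operator produced by $n$ steps of nonlinear PCG on $V_{j}$ with preconditioner $\hat B_{j}[\cdot]$. *)

theory Defs
  imports "HOL-Analysis.Analysis"
begin

text \<open>
  Everything lives inside an ambient Euclidean space whose inner product is the given one;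
  the space \<open>V\<close> of the method and its subspaces are sets \<open>S\<close> of vectors, and an operator
  \<open>V\<^sub>k \<rightarrow> V\<^sub>k\<close> is a function whose values are only meaningful on that set.
\<close>

definition linear_op_on :: "'a::euclidean_space set \<Rightarrow> ('a \<Rightarrow> 'a) \<Rightarrow> bool" where
  "linear_op_on S T \<longleftrightarrow>
     (\<forall>u\<in>S. T u \<in> S) \<and>
     (\<forall>u\<in>S. \<forall>v\<in>S. T (u + v) = T u + T v) \<and>
     (\<forall>c. \<forall>u\<in>S. T (c *\<^sub>R u) = c *\<^sub>R T u)"

definition spd_on :: "'a::euclidean_space set \<Rightarrow> ('a \<Rightarrow> 'a) \<Rightarrow> bool" where
  "spd_on S T \<longleftrightarrow>
     linear_op_on S T \<and>
     (\<forall>u\<in>S. \<forall>v\<in>S. T u \<bullet> v = u \<bullet> T v) \<and>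
     (\<forall>u\<in>S. u \<noteq> 0 \<longrightarrow> 0 < T u \<bullet> u)"

definition energy_inner :: "('a::euclidean_space \<Rightarrow> 'a) \<Rightarrow> 'a \<Rightarrow> 'a \<Rightarrow> real" where
  "energy_inner T u v = T u \<bullet> v"

definition energy_norm :: "('a::euclidean_space \<Rightarrow> 'a) \<Rightarrow> 'a \<Rightarrow> real" where
  "energy_norm T v = sqrt (energy_inner T v v)"

text \<open>
  The norm on operators \<open>S \<rightarrow> S\<close> induced by the energy norm of \<open>T\<close>. As in the definition of
  \<^const>\<open>onorm\<close>, the vector 0 contributes the quotient \<open>0 / 0 = 0\<close>.
\<close>

definition energy_onorm ::
    "'a::euclidean_space set \<Rightarrow> ('a \<Rightarrow> 'a) \<Rightarrow> ('a \<Rightarrow> 'a) \<Rightarrow> real" where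
  "energy_onorm S T E = (SUP v\<in>S. energy_norm T (E v) / energy_norm T v)"

text \<open>
  Spectral radius of a real operator on \<open>S\<close>: \<open>\<mu>\<close> ranges over the eigenvalues of the
  complexification, and \<open>x + \<i> y\<close> is an eigenvector with real and imaginary parts in \<open>S\<close>.
  (On \<open>S = {0}\<close> there are no eigenvalues and the value is unspecified.)
\<close>

definition spectral_radius_on :: "'a::euclidean_space set \<Rightarrow> ('a \<Rightarrow> 'a) \<Rightarrow> real" where
  "spectral_radius_on S T =
     Sup {cmod \<mu> | \<mu>. \<exists>x\<in>S. \<exists>y\<in>S. (x \<noteq> 0 \<or> y \<noteq> 0) \<and>
            T x = Re \<mu> *\<^sub>R x - Im \<mu> *\<^sub>R y \<and>
            T y = Im \<mu> *\<^sub>R x + Re \<mu> *\<^sub>R y}"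

definition orth_proj ::
    "('a::euclidean_space \<Rightarrow> 'a \<Rightarrow> real) \<Rightarrow> 'a set \<Rightarrow> 'a \<Rightarrow> 'a" where
  "orth_proj b S v = (THE w. w \<in> S \<and> (\<forall>s\<in>S. b (v - w) s = 0))"

definition adjoint_on :: "'a::euclidean_space set \<Rightarrow> ('a \<Rightarrow> 'a) \<Rightarrow> 'a \<Rightarrow> 'a" where
  "adjoint_on S T u = (THE w. w \<in> S \<and> (\<forall>v\<in>S. w \<bullet> v = u \<bullet> T v))"

text \<open>The operator \<open>A\<^sub>k\<close> on \<open>S = V\<^sub>k\<close>, given by \<open>(A\<^sub>k u, v) = (u, v)\<^sub>A\<close> for \<open>u, v \<in> S\<close>.\<close>

definition level_op :: "('a::euclidean_space \<Rightarrow> 'a) \<Rightarrow> 'a set \<Rightarrow> 'a \<Rightarrow> 'a" where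
  "level_op A S u = (THE w. w \<in> S \<and> (\<forall>v\<in>S. w \<bullet> v = energy_inner A u v))"

text \<open>
  The operator determined on \<open>S\<close> by \<open>I - R~ T = (I - R T) (I - R\<^sup>t T)\<close>, where \<open>T\<close> is
  invertible on \<open>S\<close>; this identity is solved for \<open>R~ f\<close> by inserting \<open>v = T\<^sup>-\<^sup>1 f\<close>.
\<close>

definition symm_smoother ::
    "'a::euclidean_space set \<Rightarrow> ('a \<Rightarrow> 'a) \<Rightarrow> ('a \<Rightarrow> 'a) \<Rightarrow> 'a \<Rightarrow> 'a" where
  "symm_smoother S T R f =
     (let v = inv_into S T f;
          w = v - adjoint_on S R (T v)
      in v - (w - R (T w)))"

text \<open>
  Residuals and search directions of the full nonlinear PCG method for the operator \<open>T\<close>, the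
  preconditioner \<open>B\<close> and the right-hand side \<open>f\<close>. Since \<open>x / 0 = 0\<close>, a coefficient whose
  denominator vanishes is 0.
\<close>

function pcg_r :: "('a::euclidean_space \<Rightarrow> 'a) \<Rightarrow> ('a \<Rightarrow> 'a) \<Rightarrow> 'a \<Rightarrow> nat \<Rightarrow> 'a"
  and pcg_p :: "('a \<Rightarrow> 'a) \<Rightarrow> ('a \<Rightarrow> 'a) \<Rightarrow> 'a \<Rightarrow> nat \<Rightarrow> 'a" where
  "pcg_r T B f 0 = f"
| "pcg_r T B f (Suc i) =
     pcg_r T B f i -
     (pcg_r T B f i \<bullet> pcg_p T B f i / energy_inner T (pcg_p T B f i) (pcg_p T B f i)) *\<^sub>R
       T (pcg_p T B f i)"
| "pcg_p T B f i =
     B (pcg_r T B f i) +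
     (\<Sum>j<i. (- energy_inner T (B (pcg_r T B f i)) (pcg_p T B f j) /
               energy_inner T (pcg_p T B f j) (pcg_p T B f j)) *\<^sub>R pcg_p T B f j)"
  by pat_completeness auto
termination
  by (relation "Wellfounded.measure (\<lambda>x. case x of Inl (_, _, _, i) \<Rightarrow> 2 * i | Inr (_, _, _, i) \<Rightarrow> 2 * i + 1)")
    auto

declare pcg_p.simps [simp del]

primrec pcg_u :: "('a::euclidean_space \<Rightarrow> 'a) \<Rightarrow> ('a \<Rightarrow> 'a) \<Rightarrow> 'a \<Rightarrow> nat \<Rightarrow> 'a" where
  "pcg_u T B f 0 = 0"
| "pcg_u T B f (Suc i) =
     pcg_u T B f i +
     (pcg_r T B f i \<bullet> pcg_p T B f i / energy_inner T (pcg_p T B f i) (pcg_p T B f i)) *\<^sub>R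
       pcg_p T B f i"

definition nonlinear_pcg ::
    "nat \<Rightarrow> ('a::euclidean_space \<Rightarrow> 'a) \<Rightarrow> ('a \<Rightarrow> 'a) \<Rightarrow> 'a \<Rightarrow> 'a" where
  "nonlinear_pcg n T B f = pcg_u T B f n"

text \<open>
  One symmetric cycle on \<open>S\<close> with operator \<open>T\<close>, smoother \<open>R\<close> and (possibly nonlinear) coarse
  correction \<open>C\<close> on the subspace \<open>S'\<close>.
\<close>

definition cycle_step ::
    "'a::euclidean_space set \<Rightarrow> 'a set \<Rightarrow> ('a \<Rightarrow> 'a) \<Rightarrow> ('a \<Rightarrow> 'a) \<Rightarrow> ('a \<Rightarrow> 'a) \<Rightarrow> 'a \<Rightarrow> 'a" where
  "cycle_step S S' T R C f =
     (let u1 = R f;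
          u2 = u1 + C (orth_proj (\<bullet>) S' (f - T u1))
      in u2 + adjoint_on S R (f - T u2))"

text \<open>
  The nonlinear AMLI-cycle operator with \<open>n\<close> PCG steps on each level. Levels start at 1; the
  equation for level 0 is a dummy.
\<close>

fun amli_cycle ::
    "(nat \<Rightarrow> 'a::euclidean_space set) \<Rightarrow> ('a \<Rightarrow> 'a) \<Rightarrow> (nat \<Rightarrow> 'a \<Rightarrow> 'a) \<Rightarrow> nat \<Rightarrow> nat \<Rightarrow> 'a \<Rightarrow> 'a"
  where
  "amli_cycle V A R n 0 f = 0"
| "amli_cycle V A R n (Suc 0) f = inv_into (V 1) (level_op A (V 1)) f"
| "amli_cycle V A R n (Suc (Suc k)) f =
     cycle_step (V (Suc (Suc k))) (V (Suc k)) (level_op A (V (Suc (Suc k)))) (R (Suc (Suc k)))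
       (nonlinear_pcg n (level_op A (V (Suc k))) (\<lambda>g. amli_cycle V A R n (Suc k) g)) f"

definition amli_pcg ::
    "(nat \<Rightarrow> 'a::euclidean_space set) \<Rightarrow> ('a \<Rightarrow> 'a) \<Rightarrow> (nat \<Rightarrow> 'a \<Rightarrow> 'a) \<Rightarrow> nat \<Rightarrow> nat \<Rightarrow> 'a \<Rightarrow> 'a" where
  "amli_pcg V A R n k = nonlinear_pcg n (level_op A (V k)) (amli_cycle V A R n k)"

end

theory Submission
  imports Defs
begin

text \<open>
  Let \<open>E = I - R A\<^sub>k\<close>, let \<open>E\<^sup>* = I - R\<^sup>t A\<^sub>k\<close> be its energy adjoint, and put
  \<open>\<eta> = c\<^sub>2 / c\<^sub>1\<close> and \<open>P = P\<^bsub>k-1\<^esub>\<close>. Both properties of the theorem together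
  say that \<open>\<parallel>E\<^sup>* w\<parallel>\<^sup>2 \<le> \<parallel>w\<parallel>\<^sup>2 - \<eta> \<parallel>(I - P) w\<parallel>\<^sup>2\<close> in the energy norm; by duality
  also \<open>\<parallel>E v\<parallel> \<le> \<parallel>v\<parallel>\<close>. The coarse correction fixes the component \<open>(I - P) e\<close> of
  \<open>e = E v\<close> and, by induction on the level, contracts \<open>P e\<close>. So the cycle leaves an error
  of squared norm at most \<open>(1 - \<eta>) \<parallel>(I - P) e\<parallel>\<^sup>2 + \<delta> \<parallel>P e\<parallel>\<^sup>2 \<le> \<delta> \<parallel>v\<parallel>\<^sup>2\<close>, since
  \<open>1 - \<eta> \<le> 1 / (1 + \<eta>) = \<delta>\<close>. Each step of full PCG is at least as good as one step of
  the preconditioned iteration, which gives \<open>\<delta>\<^sup>n\<close>.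
\<close>

section \<open>Riesz representation and adjoints on a subspace\<close>

text \<open>The representer is the combination of an orthonormal basis of \<open>S\<close> with
  coefficients \<open>f b\<close>. The \<open>THE\<close> in \<open>adjoint_on\<close>,
  \<open>level_op\<close> and \<open>orth_proj\<close> rests on this unique existence.\<close>

lemma riesz_on:
  fixes f :: "'a::euclidean_space \<Rightarrow> real"
  assumes S: "subspace S"
    and add: "\<And>u v. u \<in> S \<Longrightarrow> v \<in> S \<Longrightarrow> f (u + v) = f u + f v"
    and scale: "\<And>c u. u \<in> S \<Longrightarrow> f (c *\<^sub>R u) = c * f u"
  shows "\<exists>!w. w \<in> S \<and> (\<forall>v\<in>S. w \<bullet> v = f v)"
proof -
  obtain B where B: "B \<subseteq> S" "pairwise orthogonal B" "\<And>x. x \<in> B \<Longrightarrow> norm x = 1"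
      "independent B" "span B = S"
    using orthonormal_basis_subspace[OF S] by metis
  have fin: "finite B"
    using B(4) independent_imp_finite by blast
  define w where "w = (\<Sum>b\<in>B. f b *\<^sub>R b)"
  have wS: "w \<in> S"
    unfolding w_def using B(1) S by (intro subspace_sum) (auto intro: subspace_scale)
  have wb: "w \<bullet> b = f b" if "b \<in> B" for b
  proof -
    have "w \<bullet> b = (\<Sum>c\<in>B. if c = b then f b else 0)"
      unfolding w_def inner_sum_left
      using B(2,3) that
      by (intro sum.cong) (auto simp: pairwise_def orthogonal_def norm_eq_1)
    then show ?thesis
      using fin that by simp
  qed
  have wf: "w \<bullet> v = f v" if "v \<in> S" for v
  proof -
    have "v \<in> span B"
      using that B(5) by simp
    \<comment> \<open>Since \<open>f\<close> is additive and homogeneous on \<open>S\<close> only,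
      membership is carried through the span induction.\<close>
    then have "v \<in> S \<and> w \<bullet> v = f v"
    proof (induction rule: span_induct_alt)
      case base
      then show ?case
        using scale[of 0 0] subspace_0[OF S] by simp
    next
      case (step c x y)
      have x: "x \<in> S" "c *\<^sub>R x \<in> S"
        using step B(1) S by (auto intro: subspace_scale)
      then show ?case
        using step S wb[of x] add[of "c *\<^sub>R x" y] scale[of x c]
        by (simp add: inner_add_right subspace_add)
    qed
    then show ?thesis ..
  qed
  have ex: "w \<in> S \<and> (\<forall>v\<in>S. w \<bullet> v = f v)"
    using wS wf by blast
  show ?thesis
  proof (rule ex1I[of _ w])
    show "w \<in> S \<and> (\<forall>v\<in>S. w \<bullet> v = f v)"
      by (rule ex)
  next
    fix w' assume w': "w' \<in> S \<and> (\<forall>v\<in>S. w' \<bullet> v = f v)"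
    then have "w' - w \<in> S"
      using wS S by (simp add: subspace_diff)
    then have "(w' - w) \<bullet> (w' - w) = 0"
      using w' ex by (simp add: inner_diff_left)
    then show "w' = w"
      by simp
  qed
qed

lemma adjoint_on:
  assumes "subspace S" and "linear_op_on S R"
  shows adjoint_on_mem: "adjoint_on S R u \<in> S"
    and adjoint_on_inner: "v \<in> S \<Longrightarrow> adjoint_on S R u \<bullet> v = u \<bullet> R v"
proof -
  have "\<exists>!w. w \<in> S \<and> (\<forall>v\<in>S. w \<bullet> v = u \<bullet> R v)"
    using assms by (intro riesz_on) (auto simp: linear_op_on_def inner_add_right)
  from theI'[OF this] show "adjoint_on S R u \<in> S"
    and "v \<in> S \<Longrightarrow> adjoint_on S R u \<bullet> v = u \<bullet> R v"
    by (auto simp: adjoint_on_def)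
qed

section \<open>Geometry of the energy inner product\<close>

text \<open>Models a single level. Two instances, coarse and fine, meet in the induction over the
  levels.\<close>

locale energy_space =
  fixes S :: "'a::euclidean_space set" and T :: "'a \<Rightarrow> 'a"
  assumes subspace: "subspace S" and spd: "spd_on S T"
begin

lemma op_mem: "u \<in> S \<Longrightarrow> T u \<in> S"
  and op_add: "u \<in> S \<Longrightarrow> v \<in> S \<Longrightarrow> T (u + v) = T u + T v"
  and op_scale: "u \<in> S \<Longrightarrow> T (c *\<^sub>R u) = c *\<^sub>R T u"
  using spd by (auto simp: spd_on_def linear_op_on_def)

lemma op_diff: "u \<in> S \<Longrightarrow> v \<in> S \<Longrightarrow> T (u - v) = T u - T v"
  using op_add[of u "-1 *\<^sub>R v"] op_scale[of v "-1"] subspace_neg[OF subspace] by simp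

lemma energy_sym: "u \<in> S \<Longrightarrow> v \<in> S \<Longrightarrow> energy_inner T u v = energy_inner T v u"
  using spd by (auto simp: spd_on_def energy_inner_def inner_commute)

lemma op_zero [simp]: "T 0 = 0"
  using op_scale[of 0 0] subspace_0[OF subspace] by simp

lemma energy_nonneg: "u \<in> S \<Longrightarrow> 0 \<le> energy_inner T u u"
  using spd by (cases "u = 0") (auto simp: spd_on_def energy_inner_def less_imp_le)

lemma energy_eq_0_iff: "u \<in> S \<Longrightarrow> energy_inner T u u = 0 \<longleftrightarrow> u = 0"
  using spd by (fastforce simp: spd_on_def energy_inner_def)

lemma energy_norm_sq: "u \<in> S \<Longrightarrow> (energy_norm T u)\<^sup>2 = energy_inner T u u"
  by (simp add: energy_norm_def energy_nonneg)

lemma energy_add_left: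
  "u \<in> S \<Longrightarrow> v \<in> S \<Longrightarrow> energy_inner T (u + v) w = energy_inner T u w + energy_inner T v w"
  by (simp add: energy_inner_def op_add inner_add_left)

lemma energy_diff_left:
  "u \<in> S \<Longrightarrow> v \<in> S \<Longrightarrow> energy_inner T (u - v) w = energy_inner T u w - energy_inner T v w"
  by (simp add: energy_inner_def op_diff inner_diff_left)

lemma energy_pythagoras:
  assumes "u \<in> S" "v \<in> S" "energy_inner T u v = 0"
  shows "energy_inner T (u + v) (u + v) = energy_inner T u u + energy_inner T v v"
  using assms energy_sym[of u v] energy_add_left[of u v "u + v"]
  by (simp add: energy_inner_def inner_add_right)

lemma energy_Cauchy_Schwarz:
  assumes u: "u \<in> S" and v: "v \<in> S"
  shows "(energy_inner T u v)\<^sup>2 \<le> energy_inner T u u * energy_inner T v v"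
proof (cases "v = 0")
  case True
  then show ?thesis by (simp add: energy_inner_def)
next
  case False
  then have pos: "0 < energy_inner T v v"
    using energy_nonneg energy_eq_0_iff v by (simp add: order_less_le)
  \<comment> \<open>The minimiser of the energy of \<open>u - c v\<close>.\<close>
  define c where "c = energy_inner T u v / energy_inner T v v"
  have cv: "c *\<^sub>R v \<in> S"
    using subspace v by (simp add: subspace_scale)
  have "0 \<le> energy_inner T (u - c *\<^sub>R v) (u - c *\<^sub>R v)"
    using subspace u cv by (intro energy_nonneg subspace_diff)
  also have "\<dots> = energy_inner T u u - 2 * c * energy_inner T u v + c\<^sup>2 * energy_inner T v v"
    using energy_sym[OF u v] v
    by (simp add: energy_inner_def op_diff[OF u cv] op_scale inner_diff_left inner_diff_right
        algebra_simps power2_eq_square)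
  also have "\<dots> = energy_inner T u u - (energy_inner T u v)\<^sup>2 / energy_inner T v v"
    using pos by (simp add: c_def power2_eq_square)
  finally show ?thesis
    using pos by (simp add: divide_simps)
qed

text \<open>Gives meaning to \<open>inv_into\<close> in \<open>symm_smoother\<close> and in the
  coarsest solve, and lets every right-hand side in \<open>S\<close> be written as
  \<open>T v\<close> with \<open>v\<close> the exact solution.\<close>

lemma bij_betw_op: "bij_betw T S S"
proof -
  have inj: "inj_on T S"
  proof (rule inj_onI)
    fix u v assume uv: "u \<in> S" "v \<in> S" "T u = T v"
    then have "energy_inner T (u - v) (u - v) = 0"
      by (simp add: energy_inner_def op_diff)
    then show "u = v"
      using uv subspace energy_eq_0_iff[of "u - v"] by (simp add: subspace_diff)
  qed
  have "y \<in> T ` S" if y: "y \<in> S" for y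
  proof -
    \<comment> \<open>A vector of \<open>S\<close> orthogonal to the range of \<open>T\<close> is energy-orthogonal to itself.\<close>
    have sub: "subspace (T ` S)"
    proof (rule subspaceI)
      show "0 \<in> T ` S"
        using subspace_0[OF subspace] by (intro image_eqI[of _ _ 0]) auto
    next
      fix a b assume "a \<in> T ` S" "b \<in> T ` S"
      then show "a + b \<in> T ` S"
        using op_add subspace_add[OF subspace] by (force simp: image_iff)
    next
      fix c a assume "a \<in> T ` S"
      then show "c *\<^sub>R a \<in> T ` S"
        using subspace_scale[OF subspace, of _ c] by (auto simp: op_scale[symmetric])
    qed
    obtain a b where ab: "a \<in> span (T ` S)" "\<And>w. w \<in> span (T ` S) \<Longrightarrow> orthogonal b w" "y = a + b"
      using orthogonal_subspace_decomp_exists[of "T ` S" y] by metis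
    have a: "a \<in> T ` S"
      using ab(1) sub by (simp add: span_eq_iff[THEN iffD2])
    then have "b \<in> S"
      using ab(3) y op_mem subspace subspace_diff[of S y a] by auto
    moreover have "orthogonal b (T b)"
      using ab(2) \<open>b \<in> S\<close> by (simp add: span_base)
    ultimately have "b = 0"
      using energy_eq_0_iff by (simp add: energy_inner_def orthogonal_def inner_commute)
    then show ?thesis
      using a ab(3) by simp
  qed
  then show ?thesis
    using inj op_mem by (auto simp: bij_betw_def)
qed

lemma inv_into_op: "v \<in> S \<Longrightarrow> inv_into S T (T v) = v"
  using bij_betw_op by (simp add: bij_betw_def)

end

section \<open>Level operators and projections\<close>

text \<open>The level operator is the compression of \<open>A\<close> to \<open>S\<close>. It
  induces the same bilinear form there, so symmetry and definiteness pass down from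
  \<open>A\<close>.\<close>

lemma level_op:
  assumes A: "spd_on W A" and S: "subspace S" "S \<subseteq> W"
  shows energy_space_level_op: "energy_space S (level_op A S)"
    and level_op_inner: "u \<in> S \<Longrightarrow> v \<in> S \<Longrightarrow> level_op A S u \<bullet> v = A u \<bullet> v"
proof -
  have uniq: "\<exists>!w. w \<in> S \<and> (\<forall>v\<in>S. w \<bullet> v = energy_inner A u v)" for u
    using S by (intro riesz_on) (auto simp: energy_inner_def inner_add_right)
  have mem: "level_op A S u \<in> S" and eq: "v \<in> S \<Longrightarrow> level_op A S u \<bullet> v = A u \<bullet> v" for u v
    using theI'[OF uniq, of u] by (auto simp: level_op_def energy_inner_def)
  show "u \<in> S \<Longrightarrow> v \<in> S \<Longrightarrow> level_op A S u \<bullet> v = A u \<bullet> v"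
    by (rule eq)
  \<comment> \<open>Linearity follows by testing: a value of the level operator is recognised by its
    inner products with \<open>S\<close>.\<close>
  have char: "level_op A S u = w" if "w \<in> S" "\<And>v. v \<in> S \<Longrightarrow> w \<bullet> v = A u \<bullet> v" for u w
    unfolding level_op_def using that
    by (intro the1_equality[OF uniq]) (auto simp: energy_inner_def)
  have lin: "\<And>u v. u \<in> S \<Longrightarrow> v \<in> S \<Longrightarrow> A (u + v) = A u + A v"
    "\<And>c u. u \<in> S \<Longrightarrow> A (c *\<^sub>R u) = c *\<^sub>R A u"
    and sym: "\<And>u v. u \<in> S \<Longrightarrow> v \<in> S \<Longrightarrow> A u \<bullet> v = u \<bullet> A v"
    and pos: "\<And>u. u \<in> S \<Longrightarrow> u \<noteq> 0 \<Longrightarrow> 0 < A u \<bullet> u"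
    using A S(2) unfolding spd_on_def linear_op_on_def by blast+
  have "linear_op_on S (level_op A S)"
    unfolding linear_op_on_def
    using mem S(1)
    by (auto intro!: char simp: subspace_add subspace_scale eq lin inner_add_left)
  moreover have "level_op A S u \<bullet> v = u \<bullet> level_op A S v" if "u \<in> S" "v \<in> S" for u v
    using that eq[of v u] eq[of u v] sym[of u v] by (simp add: inner_commute)
  ultimately show "energy_space S (level_op A S)"
    using S(1) pos eq by (auto simp: energy_space_def spd_on_def)
qed

text \<open>The projection solves the Galerkin equation on \<open>S\<close>: its image under
  \<open>level_op A S\<close> is the Euclidean projection of \<open>A v\<close>. Bijectivity of that
  operator supplies the solution.\<close>

lemma energy_proj:
  assumes A: "spd_on W A" and W: "subspace W" and S: "subspace S" "S \<subseteq> W" and v: "v \<in> W"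
  shows energy_proj_mem: "orth_proj (energy_inner A) S v \<in> S"
    and energy_proj_orth: "s \<in> S \<Longrightarrow> A (v - orth_proj (energy_inner A) S v) \<bullet> s = 0"
proof -
  interpret W: energy_space W A
    using A W by unfold_locales
  interpret L: energy_space S "level_op A S"
    using A S by (rule energy_space_level_op)
  have "\<exists>!x. x \<in> S \<and> (\<forall>s\<in>S. x \<bullet> s = A v \<bullet> s)"
    using S by (intro riesz_on) (auto simp: inner_add_right)
  then obtain x where x: "x \<in> S" "\<And>s. s \<in> S \<Longrightarrow> x \<bullet> s = A v \<bullet> s"
    by blast
  then obtain w where w: "w \<in> S" "level_op A S w = x"
    using L.bij_betw_op by (metis bij_betw_imp_surj_on imageE)
  have ex: "w \<in> S \<and> (\<forall>s\<in>S. energy_inner A (v - w) s = 0)"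
    using w x S v level_op_inner[OF A S w(1)]
    by (auto simp: energy_inner_def W.op_diff subset_iff inner_diff_left)
  \<comment> \<open>The difference of two candidates lies in \<open>S\<close> and is
    energy-orthogonal to \<open>S\<close>, hence to itself.\<close>
  have "w' = w" if w': "w' \<in> S \<and> (\<forall>s\<in>S. energy_inner A (v - w') s = 0)" for w'
  proof -
    have d: "w' - w \<in> S"
      using w' w S(1) by (simp add: subspace_diff)
    have "energy_inner A (w' - w) (w' - w)
        = energy_inner A (v - w) (w' - w) - energy_inner A (v - w') (w' - w)"
      using w w' S(2) v by (simp add: energy_inner_def W.op_diff subset_iff inner_diff_left)
    also have "\<dots> = 0"
      using d w' ex by simp
    finally show ?thesis
      using W.energy_eq_0_iff[of "w' - w"] d S(2) by (auto simp: subset_iff)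
  qed
  with ex have "\<exists>!w. w \<in> S \<and> (\<forall>s\<in>S. energy_inner A (v - w) s = 0)"
    by blast
  from theI'[OF this] show "orth_proj (energy_inner A) S v \<in> S"
    and "s \<in> S \<Longrightarrow> A (v - orth_proj (energy_inner A) S v) \<bullet> s = 0"
    by (auto simp: orth_proj_def energy_inner_def)
qed

lemma orth_proj_inner_eq:
  assumes S: "subspace S" and w: "w \<in> S" "\<And>s. s \<in> S \<Longrightarrow> w \<bullet> s = x \<bullet> s"
  shows "orth_proj (\<bullet>) S x = w"
proof -
  have "\<exists>!w. w \<in> S \<and> (\<forall>s\<in>S. w \<bullet> s = x \<bullet> s)"
    using S by (intro riesz_on) (auto simp: inner_add_right)
  then show ?thesis
    unfolding orth_proj_def
    by (intro the_equality) (use w in \<open>auto simp: inner_diff_left\<close>)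
qed

section \<open>Full nonlinear PCG\<close>

context energy_space
begin

text \<open>Full orthogonalisation is Gram-Schmidt in the energy inner product, so it works for any
  map \<open>B\<close> of \<open>S\<close> into itself. As the right-hand side is
  \<open>T v\<close>, the error is \<open>v - u\<close>. One induction proves all claims, since its
  step uses them together.\<close>

lemma pcg_orthogonality:
  assumes B: "\<And>f. f \<in> S \<Longrightarrow> B f \<in> S" and v: "v \<in> S"
  shows "pcg_u T B (T v) i \<in> S \<and> pcg_r T B (T v) i = T (v - pcg_u T B (T v) i) \<and>
    (\<forall>j<i. pcg_p T B (T v) j \<in> S \<and>
       energy_inner T (v - pcg_u T B (T v) i) (pcg_p T B (T v) j) = 0 \<and>
       (\<forall>l<j. energy_inner T (pcg_p T B (T v) j) (pcg_p T B (T v) l) = 0))"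
proof (induction i)
  case 0
  then show ?case
    using subspace_0[OF subspace] by simp
next
  case (Suc i)
  define u where "u = pcg_u T B (T v)"
  define r where "r = pcg_r T B (T v)"
  define p where "p = pcg_p T B (T v)"
  define \<alpha> where "\<alpha> = r i \<bullet> p i / energy_inner T (p i) (p i)"
  have ui: "u i \<in> S" and ri: "r i = T (v - u i)" and pS: "\<And>j. j < i \<Longrightarrow> p j \<in> S"
    and ep: "\<And>j. j < i \<Longrightarrow> energy_inner T (v - u i) (p j) = 0"
    and pp: "\<And>j l. j < i \<Longrightarrow> l < j \<Longrightarrow> energy_inner T (p j) (p l) = 0"
    using Suc.IH by (auto simp: u_def r_def p_def)
  have ei: "v - u i \<in> S"
    using v ui subspace by (simp add: subspace_diff)
  have q: "B (r i) \<in> S"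
    using B ri ei op_mem by simp
  have pi: "p i = B (r i) +
      (\<Sum>j<i. (- energy_inner T (B (r i)) (p j) / energy_inner T (p j) (p j)) *\<^sub>R p j)"
    unfolding p_def r_def by (subst pcg_p.simps) simp
  have piS: "p i \<in> S"
    unfolding pi using q pS subspace
    by (intro subspace_add subspace_sum) (auto intro!: subspace_scale simp del: scaleR_minus_left)
  have pp_ne: "energy_inner T (p l) (p j) = 0" if "l < i" "j < i" "j \<noteq> l" for l j
    using that pp[of l j] pp[of j l] energy_sym[of "p l" "p j"] pS by (cases "j < l") auto
  have pil: "energy_inner T (p i) (p l) = 0" if l: "l < i" for l
  proof -
    have "energy_inner T (p i) (p l) = energy_inner T (p l) (p i)"
      using energy_sym piS pS l by simp
    also have "\<dots> = energy_inner T (p l) (B (r i)) +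
        (\<Sum>j<i. - energy_inner T (B (r i)) (p j) / energy_inner T (p j) (p j) * energy_inner T (p l) (p j))"
      unfolding pi energy_inner_def by (simp add: inner_add_right inner_sum_right)
    \<comment> \<open>Only the term \<open>j = l\<close> survives. If \<open>p l = 0\<close>, its
      coefficient is 0 by convention and both sides vanish.\<close>
    also have "(\<Sum>j<i. - energy_inner T (B (r i)) (p j) / energy_inner T (p j) (p j) * energy_inner T (p l) (p j))
        = (\<Sum>j<i. if j = l then - energy_inner T (B (r i)) (p l) else 0)"
      using l pp_ne energy_eq_0_iff[OF pS[OF l]]
      by (intro sum.cong) (auto simp: energy_inner_def)
    also have "energy_inner T (p l) (B (r i)) + \<dots> = 0"
      using l energy_sym[OF q pS[OF l]] by simp
    finally show ?thesis .
  qed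
  have uSuc: "u (Suc i) = u i + \<alpha> *\<^sub>R p i"
    by (simp add: u_def r_def p_def \<alpha>_def)
  have ap: "\<alpha> *\<^sub>R p i \<in> S"
    using piS subspace by (simp add: subspace_scale)
  have e_Suc: "v - u (Suc i) = (v - u i) - \<alpha> *\<^sub>R p i"
    by (simp add: uSuc)
  have "u (Suc i) \<in> S"
    using uSuc ui ap subspace by (simp add: subspace_add)
  moreover have "r (Suc i) = T (v - u (Suc i))"
    unfolding e_Suc using op_diff[OF ei ap] ri op_scale[OF piS]
    by (simp add: r_def p_def \<alpha>_def)
  moreover have "energy_inner T (v - u (Suc i)) (p j) = 0" if "j < Suc i" for j
  proof -
    have *: "energy_inner T (v - u (Suc i)) (p j)
        = energy_inner T (v - u i) (p j) - \<alpha> * energy_inner T (p i) (p j)"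
      unfolding e_Suc energy_diff_left[OF ei ap] by (simp add: energy_inner_def op_scale piS)
    show ?thesis
    proof (cases "j = i")
      \<comment> \<open>\<alpha> is the exact line search: as \<open>r i\<close> is \<open>T\<close>
        of the error, it removes the error component along \<open>p i\<close>. For
        \<open>p i = 0\<close> the claim is trivial.\<close>
      case True
      then show ?thesis
        unfolding * \<alpha>_def ri using energy_eq_0_iff[OF piS]
        by (cases "p i = 0") (auto simp: energy_inner_def)
    next
      case False
      then show ?thesis
        using * ep pil that by simp
    qed
  qed
  moreover have "p j \<in> S" if "j < Suc i" for j
    using that pS piS less_Suc_eq by auto
  moreover have "energy_inner T (p j) (p l) = 0" if "j < Suc i" "l < j" for j l
    using that pp pil less_Suc_eq by auto
  ultimately show ?case
    by (auto simp: u_def r_def p_def)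
qed

text \<open>
  The new error is energy-orthogonal to all search directions, whose span contains its
  difference from the error of the plain iteration \<open>e \<mapsto> e - B (T e)\<close>.
\<close>

lemma nonlinear_pcg_contraction:
  assumes B: "\<And>f. f \<in> S \<Longrightarrow> B f \<in> S" and v: "v \<in> S" and "0 \<le> \<delta>"
    and contr: "\<And>w. w \<in> S \<Longrightarrow>
      energy_inner T (w - B (T w)) (w - B (T w)) \<le> \<delta> * energy_inner T w w"
  shows "nonlinear_pcg n T B (T v) \<in> S"
    and "energy_inner T (v - nonlinear_pcg n T B (T v)) (v - nonlinear_pcg n T B (T v))
      \<le> \<delta> ^ n * energy_inner T v v"
proof -
  define u where "u = pcg_u T B (T v)"
  define r where "r = pcg_r T B (T v)"
  define p where "p = pcg_p T B (T v)"
  have uS: "u i \<in> S" and ri: "r i = T (v - u i)" for i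
    using pcg_orthogonality[where B = B and i = i, OF B v] by (auto simp: u_def r_def)
  have pS: "p j \<in> S" for j
    using pcg_orthogonality[where B = B and i = "Suc j", OF B v] by (auto simp: p_def)
  have ep: "energy_inner T (v - u i) (p j) = 0" if "j < i" for i j
    using pcg_orthogonality[where B = B and i = i, OF B v] that by (auto simp: u_def p_def)
  show "nonlinear_pcg n T B (T v) \<in> S"
    using uS by (simp add: nonlinear_pcg_def u_def)
  have eS: "v - u i \<in> S" for i
    using v uS subspace by (simp add: subspace_diff)
  have step: "energy_inner T (v - u (Suc i)) (v - u (Suc i)) \<le> \<delta> * energy_inner T (v - u i) (v - u i)" for i
  proof -
    define \<alpha> where "\<alpha> = r i \<bullet> p i / energy_inner T (p i) (p i)"
    define c where "c j = - energy_inner T (B (r i)) (p j) / energy_inner T (p j) (p j)" for j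
    \<comment> \<open>The bracket equals \<open>B (r i)\<close>, so adding \<open>d\<close> to the
      PCG error gives the error of one plain iteration.\<close>
    define d where "d = \<alpha> *\<^sub>R p i - (p i - (\<Sum>j<i. c j *\<^sub>R p j))"
    have dS: "d \<in> S"
      unfolding d_def using pS subspace
      by (intro subspace_diff subspace_sum) (auto simp: subspace_scale)
    have "p i = B (r i) + (\<Sum>j<i. c j *\<^sub>R p j)"
      unfolding p_def r_def c_def by (subst pcg_p.simps) simp
    moreover have "u (Suc i) = u i + \<alpha> *\<^sub>R p i"
      by (simp add: u_def r_def p_def \<alpha>_def)
    ultimately have eq: "(v - u i) - B (T (v - u i)) = (v - u (Suc i)) + d"
      by (simp add: d_def ri[symmetric] algebra_simps)
    have "energy_inner T (v - u (Suc i)) d = 0"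
      unfolding d_def using ep[of _ "Suc i"]
      by (simp add: energy_inner_def inner_diff_right inner_sum_right)
    then have "energy_inner T (v - u (Suc i)) (v - u (Suc i))
        \<le> energy_inner T ((v - u (Suc i)) + d) ((v - u (Suc i)) + d)"
      using energy_pythagoras[OF eS dS] energy_nonneg[OF dS] by simp
    also have "\<dots> \<le> \<delta> * energy_inner T (v - u i) (v - u i)"
      unfolding eq[symmetric] by (rule contr[OF eS])
    finally show ?thesis .
  qed
  have "energy_inner T (v - u i) (v - u i) \<le> \<delta> ^ i * energy_inner T v v" for i
  proof (induction i)
    case 0
    then show ?case by (simp add: u_def)
  next
    case (Suc i)
    then show ?case
      using step[of i] mult_left_mono[OF Suc \<open>0 \<le> \<delta>\<close>] by (simp add: mult.assoc)
  qed
  then show "energy_inner T (v - nonlinear_pcg n T B (T v)) (v - nonlinear_pcg n T B (T v))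
      \<le> \<delta> ^ n * energy_inner T v v"
    by (simp add: nonlinear_pcg_def u_def)
qed

section \<open>Smoothers and the two-level cycle\<close>

text \<open>Symmetry of \<open>T\<close> carries the Euclidean adjoint over to the energy inner
  product: the energy adjoint of \<open>R T\<close> is \<open>R^t T\<close>.\<close>

lemma smoother_adjoint:
  assumes R: "linear_op_on S R" and u: "u \<in> S" and v: "v \<in> S"
  shows "energy_inner T (u - adjoint_on S R (T u)) v = energy_inner T u (v - R (T v))"
proof -
  have "energy_inner T (adjoint_on S R (T u)) v = energy_inner T v (adjoint_on S R (T u))"
    using adjoint_on_mem[OF subspace R] v by (rule energy_sym)
  also have "\<dots> = adjoint_on S R (T u) \<bullet> T v"
    by (simp add: energy_inner_def inner_commute)
  also have "\<dots> = T u \<bullet> R (T v)"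
    using adjoint_on_inner[OF subspace R] v op_mem by blast
  finally show ?thesis
    using energy_diff_left[OF u adjoint_on_mem[OF subspace R]]
    by (simp add: energy_inner_def inner_diff_right)
qed

text \<open>With \<open>E = I - R T\<close> and its energy adjoint \<open>E*\<close>, the
  symmetrised smoother satisfies \<open>I - R~ T = E E*\<close>. This turns the smoothing property
  into energy damping by the post-smoother.\<close>

lemma symm_smoother_inner:
  assumes R: "linear_op_on S R" and w: "w \<in> S"
  shows "symm_smoother S T R (T w) \<bullet> T w = energy_inner T w w
    - energy_inner T (w - adjoint_on S R (T w)) (w - adjoint_on S R (T w))"
proof -
  define x where "x = w - adjoint_on S R (T w)"
  have x: "x \<in> S"
    unfolding x_def using w adjoint_on_mem[OF subspace R] subspace by (simp add: subspace_diff)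
  have "symm_smoother S T R (T w) = w - (x - R (T x))"
    using w by (simp add: symm_smoother_def Let_def inv_into_op x_def)
  then have "symm_smoother S T R (T w) \<bullet> T w = energy_inner T w w - energy_inner T w (x - R (T x))"
    by (simp add: energy_inner_def inner_commute inner_diff_right)
  then show ?thesis
    using smoother_adjoint[OF R w x] by (simp add: x_def)
qed

text \<open>Duality: the energy of \<open>E v\<close> is the energy product of \<open>E* E v\<close>
  and \<open>v\<close>. Cauchy-Schwarz and the bound on \<open>E*\<close> leave one factor to
  cancel.\<close>

lemma smoother_nonexpansive:
  assumes R: "linear_op_on S R" and v: "v \<in> S"
    and adj: "\<And>w. w \<in> S \<Longrightarrow> energy_inner T (w - adjoint_on S R (T w)) (w - adjoint_on S R (T w))
      \<le> energy_inner T w w"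
  shows "energy_inner T (v - R (T v)) (v - R (T v)) \<le> energy_inner T v v"
proof -
  define e where "e = v - R (T v)"
  define x where "x = e - adjoint_on S R (T e)"
  have e: "e \<in> S"
    unfolding e_def using v R op_mem subspace by (simp add: linear_op_on_def subspace_diff)
  have x: "x \<in> S"
    unfolding x_def using e adjoint_on_mem[OF subspace R] subspace by (simp add: subspace_diff)
  have "(energy_inner T e e)\<^sup>2 = (energy_inner T x v)\<^sup>2"
    using smoother_adjoint[OF R e v] by (simp add: e_def x_def)
  also have "\<dots> \<le> energy_inner T x x * energy_inner T v v"
    using x v by (rule energy_Cauchy_Schwarz)
  also have "\<dots> \<le> energy_inner T e e * energy_inner T v v"
    using adj[OF e] energy_nonneg[OF v] by (simp add: x_def mult_right_mono)
  finally show ?thesis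
    using energy_nonneg[OF e] energy_nonneg[OF v] unfolding e_def[symmetric]
    by (cases "energy_inner T e e = 0") (auto simp: power2_eq_square)
qed

text \<open>
  The post-smoother damps the energy of the component orthogonal to \<open>S'\<close>, which the coarse
  correction leaves unchanged, while the correction contracts the component in \<open>S'\<close>.
\<close>

lemma cycle_step_contraction:
  assumes S': "subspace S'" "S' \<subseteq> S" and R: "linear_op_on S R" and v: "v \<in> S"
    and P: "\<And>w. w \<in> S \<Longrightarrow> P w \<in> S'" "\<And>w s. w \<in> S \<Longrightarrow> s \<in> S' \<Longrightarrow> energy_inner T (w - P w) s = 0"
    and T': "energy_space S' T'" "\<And>u s. u \<in> S' \<Longrightarrow> s \<in> S' \<Longrightarrow> T' u \<bullet> s = T u \<bullet> s"
    and C: "\<And>w. w \<in> S' \<Longrightarrow> C (T' w) \<in> S'"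
    and contr: "\<And>w. w \<in> S' \<Longrightarrow>
      energy_inner T' (w - C (T' w)) (w - C (T' w)) \<le> \<delta> * energy_inner T' w w"
    and \<eta>: "0 \<le> \<eta>" "1 - \<eta> \<le> \<delta>" and "0 \<le> \<delta>"
    and smooth: "\<And>w. w \<in> S \<Longrightarrow> \<eta> * energy_inner T (w - P w) (w - P w)
      \<le> symm_smoother S T R (T w) \<bullet> T w"
  shows "cycle_step S S' T R C (T v) \<in> S"
    and "energy_inner T (v - cycle_step S S' T R C (T v)) (v - cycle_step S S' T R C (T v))
      \<le> \<delta> * energy_inner T v v"
proof -
  interpret L: energy_space S' T' by fact
  have adj: "energy_inner T (w - adjoint_on S R (T w)) (w - adjoint_on S R (T w))
      \<le> energy_inner T w w - \<eta> * energy_inner T (w - P w) (w - P w)" if "w \<in> S" for w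
    using smooth[OF that] symm_smoother_inner[OF R that] by simp
  have Pd: "w - P w \<in> S" if "w \<in> S" for w
    using P(1)[OF that] that S'(2) subspace by (simp add: subspace_diff subset_iff)
  have adj_le: "energy_inner T (w - adjoint_on S R (T w)) (w - adjoint_on S R (T w))
      \<le> energy_inner T w w" if "w \<in> S" for w
    using adj[OF that] energy_nonneg[OF Pd[OF that]] \<eta>(1)
      mult_nonneg_nonneg[of \<eta> "energy_inner T (w - P w) (w - P w)"] by linarith
  \<comment> \<open>The error \<open>e\<close> after pre-smoothing splits into its coarse part
    \<open>g\<close> and the rest \<open>h\<close>; \<open>y\<close> is the coarse error left by the
    correction, and \<open>x\<close> is the error before post-smoothing.\<close>
  define e where "e = v - R (T v)"
  define g where "g = P e"
  define y where "y = g - C (T' g)"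
  define h where "h = e - g"
  define x where "x = h + y"
  have Rv: "R (T v) \<in> S"
    using v R op_mem by (simp add: linear_op_on_def)
  have e: "e \<in> S"
    unfolding e_def using v Rv subspace by (simp add: subspace_diff)
  have g: "g \<in> S'"
    using P(1)[OF e] g_def by simp
  have y: "y \<in> S'"
    unfolding y_def using g C S'(1) by (simp add: subspace_diff)
  have h: "h \<in> S"
    using Pd[OF e] by (simp add: h_def g_def)
  have hs: "energy_inner T h s = 0" if "s \<in> S'" for s
    using P(2)[OF e that] by (simp add: h_def g_def)
  have xS: "x \<in> S"
    unfolding x_def using h y S'(2) subspace by (auto intro: subspace_add)
  have T'_eq: "energy_inner T' u u = energy_inner T u u" if "u \<in> S'" for u
    using T'(2)[OF that that] by (simp add: energy_inner_def)
  \<comment> \<open>\<open>P\<close> is known only through its orthogonality, so the coarse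
    discrepancy \<open>d\<close> is shown to be energy-orthogonal to itself.\<close>
  have Px: "x - P x = h"
  proof -
    define d where "d = y - P x"
    have d: "d \<in> S'"
      unfolding d_def using y P(1)[OF xS] S'(1) by (simp add: subspace_diff)
    then have dS: "d \<in> S"
      using S'(2) by blast
    have "x - P x = h + d"
      by (simp add: x_def d_def)
    then have "energy_inner T (h + d) d = 0"
      using P(2)[OF xS d] by simp
    then have "energy_inner T d d = 0"
      using hs[OF d] energy_add_left[OF h dS] by simp
    then show ?thesis
      using \<open>x - P x = h + d\<close> energy_eq_0_iff[OF dS] by simp
  qed
  \<comment> \<open>Galerkin identity: the restricted residual is the coarse operator applied to
    \<open>g\<close>, so \<open>g\<close> is the exact solution of the coarse problem.\<close>
  have "T (v - R (T v)) = T v - T (R (T v))"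
    using v Rv by (rule op_diff)
  then have "orth_proj (\<bullet>) S' (T v - T (R (T v))) = orth_proj (\<bullet>) S' (T e)"
    by (simp add: e_def)
  also have "\<dots> = T' g"
  proof (rule orth_proj_inner_eq[OF S'(1) L.op_mem[OF g]])
    fix s assume s: "s \<in> S'"
    have "g \<in> S"
      using g S'(2) by blast
    then show "T' g \<bullet> s = T e \<bullet> s"
      using hs[OF s] T'(2)[OF g s] energy_diff_left[OF e]
      by (simp add: h_def energy_inner_def)
  qed
  finally have Q: "orth_proj (\<bullet>) S' (T v - T (R (T v))) = T' g" .
  define u where "u = R (T v) + C (T' g)"
  have vu: "v - u = x"
    by (simp add: u_def x_def h_def y_def e_def)
  have u: "u \<in> S"
    unfolding u_def using Rv C[OF g] S'(2) subspace by (auto intro: subspace_add)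
  have cyc: "cycle_step S S' T R C (T v) = u + adjoint_on S R (T x)"
    using op_diff[OF v u] by (simp add: cycle_step_def Let_def Q u_def[symmetric] vu)
  then show "cycle_step S S' T R C (T v) \<in> S"
    using u adjoint_on_mem[OF subspace R] subspace by (simp add: subspace_add)
  have "v - cycle_step S S' T R C (T v) = x - adjoint_on S R (T x)"
    using cyc vu by (simp add: algebra_simps)
  then have "energy_inner T (v - cycle_step S S' T R C (T v)) (v - cycle_step S S' T R C (T v))
      \<le> energy_inner T x x - \<eta> * energy_inner T h h"
    using adj[OF xS] Px by simp
  also have "energy_inner T x x = energy_inner T h h + energy_inner T y y"
    unfolding x_def using h y hs[OF y] S'(2) by (auto intro: energy_pythagoras)
  also have "energy_inner T y y \<le> \<delta> * energy_inner T g g"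
    using contr[OF g] T'_eq[OF g] T'_eq[OF y] by (simp add: y_def)
  also have "energy_inner T h h + \<delta> * energy_inner T g g - \<eta> * energy_inner T h h
      = (1 - \<eta>) * energy_inner T h h + \<delta> * energy_inner T g g"
    by (simp add: algebra_simps)
  \<comment> \<open>Damping has lowered the factor of \<open>h\<close> to \<open>1 - \<eta>\<close>;
    bounding it by \<delta>, the factor of \<open>g\<close>, lets Pythagoras recombine both parts
    into \<open>e\<close>.\<close>
  also have "\<dots> \<le> \<delta> * energy_inner T h h + \<delta> * energy_inner T g g"
    using \<eta>(2) energy_nonneg[OF h] by (simp add: mult_right_mono)
  also have "\<dots> = \<delta> * energy_inner T (h + g) (h + g)"
    using energy_pythagoras[OF h _ hs[OF g]] g S'(2) by (auto simp: algebra_simps)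
  also have "\<dots> = \<delta> * energy_inner T e e"
    by (simp add: h_def)
  also have "\<dots> \<le> \<delta> * energy_inner T v v"
    unfolding e_def using smoother_nonexpansive[OF R v adj_le] \<open>0 \<le> \<delta>\<close> by (rule mult_left_mono)
  finally show "energy_inner T (v - cycle_step S S' T R C (T v)) (v - cycle_step S S' T R C (T v))
      \<le> \<delta> * energy_inner T v v"
    by simp
qed

end

section \<open>Induction over the levels\<close>

theorem theorem3p13:
  fixes V :: "nat \<Rightarrow> 'a::euclidean_space set"
    and A :: "'a \<Rightarrow> 'a"
    and R :: "nat \<Rightarrow> 'a \<Rightarrow> 'a"
    and J n :: nat
    and c1 c2 :: real
  defines "Ak \<equiv> \<lambda>k. level_op A (V k)"
    and "P \<equiv> \<lambda>k. orth_proj (energy_inner A) (V k)"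
  assumes "1 \<le> J" and "1 \<le> n"
    and "\<And>k. 1 \<le> k \<Longrightarrow> k \<le> J \<Longrightarrow> subspace (V k)"
    and "\<And>k. 1 \<le> k \<Longrightarrow> k < J \<Longrightarrow> V k \<subseteq> V (k + 1)"
    and "spd_on (V J) A"
    and "\<And>k. 2 \<le> k \<Longrightarrow> k \<le> J \<Longrightarrow> linear_op_on (V k) (R k)"
    and "\<And>k. 2 \<le> k \<Longrightarrow> k \<le> J \<Longrightarrow>
           energy_onorm (V k) (Ak k) (\<lambda>v. v - R k (Ak k v)) < 1"
    and "0 < c1" and "0 < c2"
    and approximation: "\<And>k v. 2 \<le> k \<Longrightarrow> k \<le> J \<Longrightarrow> v \<in> V k \<Longrightarrow>
           (energy_norm (Ak k) (v - P (k - 1) v))\<^sup>2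
             \<le> c1 / spectral_radius_on (V k) (Ak k) * (norm (Ak k v))\<^sup>2"
    and smoothing: "\<And>k v. 2 \<le> k \<Longrightarrow> k \<le> J \<Longrightarrow> v \<in> V k \<Longrightarrow>
           c2 / spectral_radius_on (V k) (Ak k) * (v \<bullet> v)
             \<le> symm_smoother (V k) (Ak k) (R k) v \<bullet> v"
  shows "let \<delta> = c1 / (c1 + c2) in
           \<delta> < 1 \<and>
           (\<forall>k\<in>{1..J}. \<forall>v\<in>V k.
              (energy_norm (Ak k) (v - amli_cycle V A R n k (Ak k v)))\<^sup>2
                \<le> \<delta> * (energy_norm (Ak k) v)\<^sup>2 \<and>
              (energy_norm (Ak k) (v - amli_pcg V A R n k (Ak k v)))\<^sup>2
                \<le> \<delta> ^ n * (energy_norm (Ak k) v)\<^sup>2)"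
proof -
  note J = assms(3) and n = assms(4) and sub = assms(5) and nest = assms(6) and spd = assms(7)
    and lin = assms(8) and c1 = \<open>0 < c1\<close> and c2 = \<open>0 < c2\<close>
  define \<delta> where "\<delta> = c1 / (c1 + c2)"
  have \<delta>: "0 \<le> \<delta>" "\<delta> < 1"
    using c1 c2 by (auto simp: \<delta>_def)
  \<comment> \<open>\<open>A\<close> is assumed definite on \<open>V J\<close>, so each level is
    embedded there to inherit its operator.\<close>
  have VJ: "V k \<subseteq> V J" if "1 \<le> k" "k \<le> J" for k
    using that(2,1)
  proof (induction rule: inc_induct)
    case base
    then show ?case by simp
  next
    case (step m)
    then show ?case
      using nest[of m] by auto
  qed
  have es: "energy_space (V k) (Ak k)" if "1 \<le> k" "k \<le> J" for k
    unfolding Ak_def using energy_space_level_op[OF spd sub[OF that] VJ[OF that]] .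
  \<comment> \<open>Membership belongs to the induction claim because the PCG estimate needs a
    preconditioner mapping the level into itself.\<close>
  have cycle: "(\<forall>f\<in>V k. amli_cycle V A R n k f \<in> V k) \<and>
      (\<forall>v\<in>V k. energy_inner (Ak k) (v - amli_cycle V A R n k (Ak k v)) (v - amli_cycle V A R n k (Ak k v))
         \<le> \<delta> * energy_inner (Ak k) v v)" if "1 \<le> k" "k \<le> J" for k
    using that
  proof (induction k rule: nat_induct_at_least)
    \<comment> \<open>The coarsest solve is exact, so the error is zero.\<close>
    case base
    interpret energy_space "V 1" "Ak 1"
      using base by (intro es) auto
    have "amli_cycle V A R n 1 (Ak 1 v) = v" if "v \<in> V 1" for v
      using inv_into_op[OF that] by (simp add: Ak_def)
    moreover have "amli_cycle V A R n 1 f \<in> V 1" if "f \<in> V 1" for f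
      using bij_betw_op that by (auto simp: bij_betw_def Ak_def intro: inv_into_into)
    ultimately show ?case
      using \<delta>(1) energy_nonneg by (auto simp: energy_inner_def)
  next
    case (Suc k)
    then have k: "1 \<le> k" "k \<le> J" "k < J" and K: "1 \<le> Suc k" "2 \<le> Suc k" "Suc k \<le> J"
      by auto
    interpret C: energy_space "V k" "Ak k"
      using k by (intro es)
    interpret F: energy_space "V (Suc k)" "Ak (Suc k)"
      using K by (intro es)
    define B where "B = amli_cycle V A R n k"
    define \<eta> where "\<eta> = c2 / c1"
    have incl: "V k \<subseteq> V (Suc k)"
      using nest[OF k(1,3)] by simp
    have B: "B f \<in> V k" if "f \<in> V k" for f
      using Suc.IH[OF k(2)] that by (simp add: B_def)
    have Bc: "energy_inner (Ak k) (w - B (Ak k w)) (w - B (Ak k w)) \<le> \<delta> * energy_inner (Ak k) w w"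
      if "w \<in> V k" for w
      using Suc.IH[OF k(2)] that by (simp add: B_def)
    have Ck: "nonlinear_pcg n (Ak k) B (Ak k w) \<in> V k" if "w \<in> V k" for w
      using C.nonlinear_pcg_contraction(1)[OF B that \<delta>(1) Bc] .
    \<comment> \<open>Here \<open>1 \<le> n\<close> enters: the coarse PCG contracts at least by
      \<delta>, which keeps the same constant on every level.\<close>
    have pow: "\<delta> ^ n \<le> \<delta>"
      using \<delta> n power_decreasing[of 1 n \<delta>] by simp
    have contr: "energy_inner (Ak k) (w - nonlinear_pcg n (Ak k) B (Ak k w)) (w - nonlinear_pcg n (Ak k) B (Ak k w))
        \<le> \<delta> * energy_inner (Ak k) w w" if "w \<in> V k" for w
      using C.nonlinear_pcg_contraction(2)[OF B that \<delta>(1) Bc, where n = n]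
        mult_right_mono[OF pow C.energy_nonneg[OF that]] by (rule order_trans)
    have inner_k: "Ak k u \<bullet> s = A u \<bullet> s" if "u \<in> V k" "s \<in> V k" for u s
      unfolding Ak_def using level_op_inner[OF spd C.subspace VJ[OF k(1,2)] that] .
    have inner_K: "Ak (Suc k) u \<bullet> s = A u \<bullet> s" if "u \<in> V (Suc k)" "s \<in> V (Suc k)" for u s
      unfolding Ak_def using level_op_inner[OF spd F.subspace VJ[OF K(1,3)] that] .
    have P1: "P k w \<in> V k" if "w \<in> V (Suc k)" for w
      unfolding P_def using energy_proj_mem[OF spd sub[OF J order_refl] C.subspace VJ[OF k(1,2)]]
        VJ[OF K(1,3)] that by blast
    have Pd: "w - P k w \<in> V (Suc k)" if "w \<in> V (Suc k)" for w
      using P1[OF that] that incl F.subspace by (auto intro: subspace_diff)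
    have P2: "energy_inner (Ak (Suc k)) (w - P k w) s = 0" if "w \<in> V (Suc k)" "s \<in> V k" for w s
    proof -
      have "A (w - P k w) \<bullet> s = 0"
        unfolding P_def using energy_proj_orth[OF spd sub[OF J order_refl] C.subspace VJ[OF k(1,2)] _ that(2)]
          VJ[OF K(1,3)] that by blast
      then show ?thesis
        using inner_K[OF Pd[OF that(1)]] that incl by (auto simp: energy_inner_def)
    qed
    \<comment> \<open>The left side is \<open>1 - \<delta>\<close>.\<close>
    have "c2 / (c1 + c2) \<le> \<eta>"
      unfolding \<eta>_def using c1 c2 by (simp add: frac_le)
    then have \<eta>: "0 \<le> \<eta>" "1 - \<eta> \<le> \<delta>"
      using c1 c2 by (auto simp: \<eta>_def \<delta>_def field_simps)
    \<comment> \<open>Approximation is taken at \<open>w\<close> and smoothing at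
      \<open>Ak (Suc k) w\<close>. Multiplying by \<eta> turns \<open>c1 / \<rho>\<close> into
      \<open>c2 / \<rho>\<close>, so the two bounds chain.\<close>
    have smooth: "\<eta> * energy_inner (Ak (Suc k)) (w - P k w) (w - P k w)
        \<le> symm_smoother (V (Suc k)) (Ak (Suc k)) (R (Suc k)) (Ak (Suc k) w) \<bullet> Ak (Suc k) w"
      if w: "w \<in> V (Suc k)" for w
    proof -
      define \<rho> where "\<rho> = spectral_radius_on (V (Suc k)) (Ak (Suc k))"
      have "\<eta> * energy_inner (Ak (Suc k)) (w - P k w) (w - P k w)
          \<le> \<eta> * (c1 / \<rho> * (norm (Ak (Suc k) w))\<^sup>2)"
        using approximation[OF K(2,3) w] \<eta>(1) F.energy_norm_sq[OF Pd[OF w]]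
        by (intro mult_left_mono) (auto simp: \<rho>_def)
      also have "\<dots> = c2 / \<rho> * (Ak (Suc k) w \<bullet> Ak (Suc k) w)"
        using c1 by (simp add: \<eta>_def dot_square_norm)
      also have "\<dots> \<le> symm_smoother (V (Suc k)) (Ak (Suc k)) (R (Suc k)) (Ak (Suc k) w) \<bullet> Ak (Suc k) w"
        unfolding \<rho>_def by (rule smoothing[OF K(2,3) F.op_mem[OF w]])
      finally show ?thesis .
    qed
    have compat: "Ak k u \<bullet> s = Ak (Suc k) u \<bullet> s" if "u \<in> V k" "s \<in> V k" for u s
      using inner_k[OF that] inner_K[of u s] that incl by (auto simp: subset_iff)
    \<comment> \<open>\<open>1 \<le> k\<close> rules out the exact solve at level 1 and leaves the
      cycle equation.\<close>
    have unfold: "amli_cycle V A R n (Suc k) f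
        = cycle_step (V (Suc k)) (V k) (Ak (Suc k)) (R (Suc k)) (nonlinear_pcg n (Ak k) B) f" for f
      using k(1) by (cases k) (auto simp: Ak_def B_def)
    note cyc = F.cycle_step_contraction[OF C.subspace incl lin[OF K(2,3)] _ P1 P2
        C.energy_space_axioms compat Ck contr \<eta> \<delta>(1) smooth]
    have "amli_cycle V A R n (Suc k) f \<in> V (Suc k)" if "f \<in> V (Suc k)" for f
    proof -
      \<comment> \<open>The cycle lemma speaks of right-hand sides of the form \<open>T v\<close>;
        surjectivity covers every \<open>f\<close>.\<close>
      obtain v where "v \<in> V (Suc k)" "f = Ak (Suc k) v"
        using F.bij_betw_op \<open>f \<in> V (Suc k)\<close> by (metis bij_betw_imp_surj_on imageE)
      then show ?thesis
        using cyc(1) unfold by simp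
    qed
    then show ?case
      using cyc(2) unfold by simp
  qed
  have "(energy_norm (Ak k) (v - amli_cycle V A R n k (Ak k v)))\<^sup>2 \<le> \<delta> * (energy_norm (Ak k) v)\<^sup>2 \<and>
      (energy_norm (Ak k) (v - amli_pcg V A R n k (Ak k v)))\<^sup>2 \<le> \<delta> ^ n * (energy_norm (Ak k) v)\<^sup>2"
    if k: "k \<in> {1..J}" and v: "v \<in> V k" for k v
  proof -
    interpret energy_space "V k" "Ak k"
      using k by (intro es) auto
    have k': "1 \<le> k" "k \<le> J"
      using k by auto
    have B: "amli_cycle V A R n k f \<in> V k" if "f \<in> V k" for f
      using cycle[OF k'] that by blast
    have contr: "energy_inner (Ak k) (w - amli_cycle V A R n k (Ak k w)) (w - amli_cycle V A R n k (Ak k w))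
         \<le> \<delta> * energy_inner (Ak k) w w" if "w \<in> V k" for w
      using cycle[OF k'] that by blast
    have pcg: "amli_pcg V A R n k = nonlinear_pcg n (Ak k) (amli_cycle V A R n k)"
      by (simp add: amli_pcg_def Ak_def)
    show ?thesis
      using contr[OF v] nonlinear_pcg_contraction[OF B v \<delta>(1) contr, where n = n] v B op_mem subspace
      unfolding pcg by (simp add: energy_norm_sq subspace_diff)
  qed
  then show ?thesis
    using \<delta>(2) by (simp add: Let_def \<delta>_def[symmetric])
qed

end
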